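(* Let $p\ge 3$, $n\ge 0$ be integers and $r=\min\{n,p\}$. Then \[ |E_1(H_p^n)|=\frac12\sum_{\mu=1}^{r}(p-\mu)\sum_{\nu=0}^{\mu}\nu\,O_p^n(\nu\mid\mu), \] \[ |E_2(H_p^n)|=\frac12\binom{p}{2}p^n-\frac14\sum_{\mu=1}^{r}(p-\mu)\sum_{\nu=0}^{\mu}(p+3\mu-2\nu-1)\,O_p^n(\nu\mid\mu), \] \[ |E_3(H_p^n)|=\sum_{\mu=1}^{r}(p-\mu)\sum_{\nu=0}^{\mu}(\mu-\nu)\,O_p^n(\nu\mid\mu). \]
   Context: For integers $p\ge 3$, $n\ge 0$, let $[p]_0=\{0,\dots,p-1\}$. The generalized Hanoi graph $H_p^n$ has vertex set $[p]_0^n$: a vertex $s=s_n\cdots s_1$ encodes a state of the Tower of Hanoi with $p$ pegs and $n$ discs of sizes $1<\dots<n$, disc $d$ lying on peg $s_d$. Two vertices are adjacent iff they have the form $\underline{s}\,i\,\overline{s}$ and $\underline{s}\,j\,\overline{s}$ with $i\ne j$, $\underline{s}\in[p]_0^{n-d}$, $\overline{s}\in([p]_0\setminus\{i,j\})^{d-1}$ for some $d$ (legal move of the top disc of peg $i$ to peg $j$). A peg is empty if it holds no disc, occupied otherwise, a singleton if it holds exactly one disc, a multiton if it holds at least two. The occupancy $o(s)$ is the number of occupied pegs. For an edge $\{u,v\}$ with $o(u)\le o(v)$, consider the move transforming $u$ into $v$ (peg types taken in $u$): $E_1(H_p^n)$ is the set of edges where this move takes a disc from a singleton peg to an empty peg;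 $E_2(H_p^n)$ those where it takes a disc from a multiton peg to an occupied peg; $E_3(H_p^n)$ those where it takes a disc from a multiton peg to an empty peg. $O_p^n(\nu\mid\mu)$ is the number of states with exactly $\mu$ occupied pegs, exactly $\nu$ of which are singletons.
   Formalization: The formula for |E_2(H_p^n)| is stated only for n ≥ 1, since at n = 0 the graph has no edges while the printed right side equals ½·binom(p,2) > 0; the formulas for E_1 and E_3 are stated for all n ≥ 0. *)

theory Defs
  imports Complex_Main "HOL-Library.FuncSet"
begin

text \<open>A state \<open>s\<^sub>n \<dots> s\<^sub>1\<close> is the function sending each disc \<open>d \<in> {1..n}\<close>
  (disc 1 is the smallest) to its peg \<open>s\<^sub>d\<close>.\<close>

definition hanoi_states :: "nat \<Rightarrow> nat \<Rightarrow> (nat \<Rightarrow> nat) set" where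
  "hanoi_states p n = {1..n} \<rightarrow>\<^sub>E {0..<p}"

definition discs_on :: "nat \<Rightarrow> (nat \<Rightarrow> nat) \<Rightarrow> nat \<Rightarrow> nat set" where
  "discs_on n s k = {d \<in> {1..n}. s d = k}"

definition empty_peg :: "nat \<Rightarrow> (nat \<Rightarrow> nat) \<Rightarrow> nat \<Rightarrow> bool" where
  "empty_peg n s k \<longleftrightarrow> discs_on n s k = {}"

definition occupied_peg :: "nat \<Rightarrow> (nat \<Rightarrow> nat) \<Rightarrow> nat \<Rightarrow> bool" where
  "occupied_peg n s k \<longleftrightarrow> \<not> empty_peg n s k"

definition singleton_peg :: "nat \<Rightarrow> (nat \<Rightarrow> nat) \<Rightarrow> nat \<Rightarrow> bool" where
  "singleton_peg n s k \<longleftrightarrow> card (discs_on n s k) = 1"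

definition multiton_peg :: "nat \<Rightarrow> (nat \<Rightarrow> nat) \<Rightarrow> nat \<Rightarrow> bool" where
  "multiton_peg n s k \<longleftrightarrow> card (discs_on n s k) \<ge> 2"

definition occupancy :: "nat \<Rightarrow> nat \<Rightarrow> (nat \<Rightarrow> nat) \<Rightarrow> nat" where
  "occupancy p n s = card {k \<in> {0..<p}. occupied_peg n s k}"

text \<open>\<open>hanoi_move p n d i j u v\<close>: moving disc \<open>d\<close> from peg \<open>i\<close> to peg \<open>j\<close> is legal in \<open>u\<close> and
  yields \<open>v\<close>. No smaller disc lies on \<open>i\<close> or \<open>j\<close>, and all other discs stay where they are.\<close>

definition hanoi_move ::
  "nat \<Rightarrow> nat \<Rightarrow> nat \<Rightarrow> nat \<Rightarrow> nat \<Rightarrow> (nat \<Rightarrow> nat) \<Rightarrow> (nat \<Rightarrow> nat) \<Rightarrow> bool" where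
  "hanoi_move p n d i j u v \<longleftrightarrow>
     u \<in> hanoi_states p n \<and> v \<in> hanoi_states p n \<and> d \<in> {1..n} \<and> i \<noteq> j \<and>
     u d = i \<and> v d = j \<and>
     (\<forall>e \<in> {1..n} - {d}. v e = u e) \<and>
     (\<forall>e \<in> {1..<d}. u e \<notin> {i, j})"

definition hanoi_edges :: "nat \<Rightarrow> nat \<Rightarrow> (nat \<Rightarrow> nat) set set" where
  "hanoi_edges p n = {{u, v} | u v. \<exists>d i j. hanoi_move p n d i j u v}"

text \<open>The edges \<open>{u, v}\<close>, oriented so that the occupancy does not decrease from \<open>u\<close> to \<open>v\<close>, whose
  move goes from a peg of type \<open>P\<close> to a peg of type \<open>Q\<close>, both types taken in \<open>u\<close>. The move
  \<open>(d, i, j)\<close> is determined by \<open>u\<close> and \<open>v\<close>. If the occupancies agree, both orientations are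
  allowed; for the three classes below they give the same peg types.\<close>

definition hanoi_edges_of_type ::
  "(nat \<Rightarrow> (nat \<Rightarrow> nat) \<Rightarrow> nat \<Rightarrow> bool) \<Rightarrow> (nat \<Rightarrow> (nat \<Rightarrow> nat) \<Rightarrow> nat \<Rightarrow> bool) \<Rightarrow>
   nat \<Rightarrow> nat \<Rightarrow> (nat \<Rightarrow> nat) set set" where
  "hanoi_edges_of_type P Q p n =
     {e \<in> hanoi_edges p n. \<exists>u v d i j.
        e = {u, v} \<and> occupancy p n u \<le> occupancy p n v \<and>
        hanoi_move p n d i j u v \<and> P n u i \<and> Q n u j}"

definition hanoi_E1 :: "nat \<Rightarrow> nat \<Rightarrow> (nat \<Rightarrow> nat) set set" where
  "hanoi_E1 = hanoi_edges_of_type singleton_peg empty_peg"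

definition hanoi_E2 :: "nat \<Rightarrow> nat \<Rightarrow> (nat \<Rightarrow> nat) set set" where
  "hanoi_E2 = hanoi_edges_of_type multiton_peg occupied_peg"

definition hanoi_E3 :: "nat \<Rightarrow> nat \<Rightarrow> (nat \<Rightarrow> nat) set set" where
  "hanoi_E3 = hanoi_edges_of_type multiton_peg empty_peg"

text \<open>\<open>hanoi_O p n \<nu> \<mu>\<close> is the number \<open>O\<^sub>p\<^sup>n(\<nu> | \<mu>)\<close>.\<close>

definition hanoi_O :: "nat \<Rightarrow> nat \<Rightarrow> nat \<Rightarrow> nat \<Rightarrow> nat" where
  "hanoi_O p n \<nu> \<mu> =
     card {s \<in> hanoi_states p n.
       occupancy p n s = \<mu> \<and> card {k \<in> {0..<p}. singleton_peg n s k} = \<nu>}"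

end

theory Submission
  imports Defs
begin

text \<open>
  Orient every move. Reversing a singleton-to-empty or a multiton-to-occupied move gives a move of
  the same kind, so \<open>E\<^sub>1\<close> and \<open>E\<^sub>2\<close> have half as many edges as there are such moves. Reversing a
  multiton-to-empty move gives a singleton-to-occupied move, so the edges of \<open>E\<^sub>3\<close> are in bijection
  with the multiton-to-empty moves. Moves to an empty peg are always legal and hence counted by
  products of peg numbers; and any two pegs that are not both empty admit exactly one move between
  them, which gives the number of all moves and thus, by difference, that of the
  multiton-to-occupied ones.
\<close>

section \<open>Unordered pairs from a relation\<close>

text \<open>The map \<open>(u, v)\<close> to \<open>{u, v}\<close> is two-to-one on
  \<open>R\<close>: symmetry puts both orders into each fibre, irreflexivity keeps them
  distinct.\<close>

lemma card_unordered_pairs_sym: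
  assumes "finite R" "sym R" "irrefl R"
  shows "card R = 2 * card {{u, v} | u v. (u, v) \<in> R}"
proof -
  let ?f = "\<lambda>(u, v). {u, v}"
  have im: "{{u, v} | u v. (u, v) \<in> R} = ?f ` R" by auto
  have fibre: "card {x \<in> R. ?f x = e} = 2" if e: "e \<in> ?f ` R" for e
  proof -
    obtain u v where uv: "(u, v) \<in> R" "e = {u, v}" using e by auto
    have "{x \<in> R. ?f x = e} = {(u, v), (v, u)}"
      using uv assms(2) by (auto simp: doubleton_eq_iff dest: symD)
    moreover have "u \<noteq> v" using uv assms(3) by (auto simp: irrefl_def)
    ultimately show ?thesis by simp
  qed
  have "card R = (\<Sum>e\<in>?f ` R. card {x \<in> R. ?f x = e})"
    using sum.image_gen[OF assms(1), of "\<lambda>_. 1::nat" ?f] by simp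
  also have "\<dots> = 2 * card (?f ` R)" using fibre by simp
  finally show ?thesis by (simp only: im)
qed

text \<open>Here only one order of each pair lies in \<open>R\<close>, so forgetting the order is
  injective.\<close>

lemma card_unordered_pairs_antisym:
  assumes "asym R"
  shows "card R = card {{u, v} | u v. (u, v) \<in> R}"
proof -
  have im: "{{u, v} | u v. (u, v) \<in> R} = (\<lambda>(u, v). {u, v}) ` R" by auto
  have "inj_on (\<lambda>(u, v). {u, v}) R"
    using assms by (auto simp: inj_on_def doubleton_eq_iff dest: asymD)
  then show ?thesis by (simp add: im card_image)
qed

section \<open>Legal moves\<close>

text \<open>An empty peg gets the virtual top disc \<open>n + 1\<close>; then a move from \<open>i\<close> to \<open>j\<close> is legal iff
  the top disc of \<open>i\<close> is smaller than that of \<open>j\<close>.\<close>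

definition top_disc :: "nat \<Rightarrow> (nat \<Rightarrow> nat) \<Rightarrow> nat \<Rightarrow> nat" where
  "top_disc n s k = Min (insert (Suc n) (discs_on n s k))"

lemma finite_discs_on [simp]: "finite (discs_on n s k)"
  by (simp add: discs_on_def)

lemma top_disc_le: "e \<in> discs_on n s k \<Longrightarrow> top_disc n s k \<le> e"
  by (simp add: top_disc_def)

lemma top_disc_le_Suc: "top_disc n s k \<le> Suc n"
  by (simp add: top_disc_def)

lemma top_disc_cases: "top_disc n s k = Suc n \<or> top_disc n s k \<in> discs_on n s k"
  unfolding top_disc_def using Min_in[of "insert (Suc n) (discs_on n s k)"] by auto

lemma top_disc_empty_iff: "top_disc n s k = Suc n \<longleftrightarrow> empty_peg n s k"
proof
  assume t: "top_disc n s k = Suc n"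
  show "empty_peg n s k" unfolding empty_peg_def
  proof (rule equals0I)
    fix e assume "e \<in> discs_on n s k"
    with top_disc_le[OF this] t show False by (simp add: discs_on_def)
  qed
qed (simp add: top_disc_def empty_peg_def)

text \<open>Distinct pegs share no actual disc, so their tops can agree only at the virtual disc
  \<open>n + 1\<close>.\<close>

lemma top_disc_eq_iff:
  "i \<noteq> j \<Longrightarrow> top_disc n s i = top_disc n s j \<longleftrightarrow> empty_peg n s i \<and> empty_peg n s j"
  using top_disc_cases[of n s i] top_disc_cases[of n s j]
  by (auto simp flip: top_disc_empty_iff simp: discs_on_def)

text \<open>Legality forces \<open>d\<close> to be the smallest disc on \<open>i\<close> and every
  disc on \<open>j\<close> to be larger. Hence a move out of \<open>u\<close> amounts to an ordered
  pair of pegs, which is what gets counted later.\<close>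

lemma hanoi_move_iff:
  "hanoi_move p n d i j u v \<longleftrightarrow>
     u \<in> hanoi_states p n \<and> i < p \<and> j < p \<and> top_disc n u i < top_disc n u j \<and>
     d = top_disc n u i \<and> v = u(d := j)"
proof
  assume m: "hanoi_move p n d i j u v"
  then have st: "u \<in> hanoi_states p n" "v \<in> hanoi_states p n" and d: "d \<in> {1..n}"
    and "i \<noteq> j" "u d = i" "v d = j" and
    same: "\<And>e. e \<in> {1..n} - {d} \<Longrightarrow> v e = u e" and
    small: "\<And>e. e \<in> {1..<d} \<Longrightarrow> u e \<noteq> i \<and> u e \<noteq> j"
    by (auto simp: hanoi_move_def)
  have ip: "i < p" "j < p"
    using st d \<open>u d = i\<close> \<open>v d = j\<close> by (auto simp: hanoi_states_def PiE_iff)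
  have "d \<in> discs_on n u i" using d \<open>u d = i\<close> by (simp add: discs_on_def)
  then have le: "top_disc n u i \<le> d" by (rule top_disc_le)
  then have "top_disc n u i \<in> discs_on n u i" using top_disc_cases[of n u i] d by auto
  \<comment> \<open>A strictly smaller top of \<open>i\<close> would be a disc below
    \<open>d\<close> on \<open>i\<close>, against legality.\<close>
  then have td: "top_disc n u i = d"
    using small[of "top_disc n u i"] le by (fastforce simp: discs_on_def)
  have "top_disc n u j > d"
    using top_disc_cases[of n u j] small[of "top_disc n u j"] d \<open>u d = i\<close> \<open>i \<noteq> j\<close>
    by (cases "top_disc n u j" d rule: linorder_cases) (auto simp: discs_on_def)
  \<comment> \<open>Outside \<open>{1..n}\<close> both functions are \<open>undefined\<close>,
    because states are extensional.\<close>
  moreover have "v = u(d := j)"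
  proof
    fix e
    show "v e = (u(d := j)) e"
      using st same[of e] \<open>v d = j\<close>
      by (cases "e \<in> {1..n}") (auto simp: hanoi_states_def PiE_iff extensional_def)
  qed
  ultimately show "u \<in> hanoi_states p n \<and> i < p \<and> j < p \<and>
      top_disc n u i < top_disc n u j \<and> d = top_disc n u i \<and> v = u(d := j)"
    using st ip td by simp
next
  assume a: "u \<in> hanoi_states p n \<and> i < p \<and> j < p \<and>
      top_disc n u i < top_disc n u j \<and> d = top_disc n u i \<and> v = u(d := j)"
  \<comment> \<open>The top of \<open>j\<close> is at most \<open>n + 1\<close>, so the strictly
    smaller top of \<open>i\<close> is an actual disc.\<close>
  have "top_disc n u i \<noteq> Suc n" using a top_disc_le_Suc[of n u j] by simp
  then have d: "d \<in> {1..n}" "u d = i"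
    using a top_disc_cases[of n u i] by (auto simp: discs_on_def)
  have "u e \<notin> {i, j}" if "e \<in> {1..<d}" for e
    using that d a top_disc_le[of e n u i] top_disc_le[of e n u j] by (auto simp: discs_on_def)
  then show "hanoi_move p n d i j u v"
    using a d by (auto simp: hanoi_move_def hanoi_states_def PiE_iff extensional_def)
qed

lemma hanoi_move_rev: "hanoi_move p n d i j u v \<Longrightarrow> hanoi_move p n d j i v u"
  by (auto simp: hanoi_move_def)

text \<open>\<open>d\<close> is the only disc on which \<open>u\<close> and \<open>v\<close> differ,
  and \<open>i\<close>, \<open>j\<close> are its positions in them.\<close>

lemma hanoi_move_unique:
  assumes "hanoi_move p n d i j u v" "hanoi_move p n d' i' j' u v"
  shows "d' = d \<and> i' = i \<and> j' = j"
  using assms unfolding hanoi_move_def by (metis DiffI singletonD)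

section \<open>Effect of a move on disc numbers and occupancy\<close>

lemma discs_on_move:
  assumes "hanoi_move p n d i j u v"
  shows "discs_on n v k =
    (if k = i then discs_on n u i - {d} else if k = j then insert d (discs_on n u j)
     else discs_on n u k)"
proof (intro set_eqI)
  fix e
  show "e \<in> discs_on n v k \<longleftrightarrow> e \<in>
    (if k = i then discs_on n u i - {d} else if k = j then insert d (discs_on n u j)
     else discs_on n u k)"
    using assms by (cases "e = d") (auto simp: hanoi_move_def discs_on_def)
qed

lemma card_discs_on_move:
  assumes "hanoi_move p n d i j u v"
  shows "card (discs_on n u i) = Suc (card (discs_on n v i))"
    and "card (discs_on n v j) = Suc (card (discs_on n u j))"
proof -
  have "d \<in> discs_on n u i" "d \<notin> discs_on n u j" "i \<noteq> j"
    using assms by (auto simp: hanoi_move_def discs_on_def)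
  then show "card (discs_on n u i) = Suc (card (discs_on n v i))"
    and "card (discs_on n v j) = Suc (card (discs_on n u j))"
    by (simp_all add: discs_on_move[OF assms] card_Suc_Diff1 del: card_Diff_insert)
qed

lemma empty_peg_card: "empty_peg n s k \<longleftrightarrow> card (discs_on n s k) = 0"
  by (simp add: empty_peg_def)

lemma occupied_peg_card: "occupied_peg n s k \<longleftrightarrow> card (discs_on n s k) \<noteq> 0"
  by (simp add: empty_peg_def occupied_peg_def)

text \<open>Expressed through disc numbers, all peg types are updated under a move by the arithmetic
  of \<open>card_discs_on_move\<close>. For this the form \<open>card A = 0\<close> has to be kept
  rather than turned back into emptiness.\<close>

lemmas peg_type_card = empty_peg_card occupied_peg_card singleton_peg_def multiton_peg_def

declare card_0_eq [simp del]

text \<open>A multiton source stays occupied, so no occupied peg is lost. A move to an empty peg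
  loses at most \<open>i\<close> but gains \<open>j\<close>. This covers the moves defining all
  three edge classes.\<close>

lemma occupancy_move_mono:
  assumes m: "hanoi_move p n d i j u v" and "multiton_peg n u i \<or> empty_peg n u j"
  shows "occupancy p n u \<le> occupancy p n v"
proof -
  let ?O = "\<lambda>s. {k \<in> {0..<p}. occupied_peg n s k}"
  have ij: "i < p" "j < p" "i \<noteq> j" using m by (auto simp: hanoi_move_iff)
  note c = card_discs_on_move[OF m]
  have other: "occupied_peg n v k \<longleftrightarrow> occupied_peg n u k" if "k \<noteq> i" "k \<noteq> j" for k
    using that by (simp add: occupied_peg_card discs_on_move[OF m])
  have j: "occupied_peg n v j" using c by (simp add: occupied_peg_card)
  show ?thesis
  proof (cases "multiton_peg n u i")
    case True
    then have "occupied_peg n v i" using c by (simp add: peg_type_card)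
    then have "occupied_peg n u k \<Longrightarrow> occupied_peg n v k" for k
      using other[of k] j by (cases "k = i \<or> k = j") auto
    then have "?O u \<subseteq> ?O v" by auto
    then show ?thesis unfolding occupancy_def by (intro card_mono) auto
  next
    case False
    then have "\<not> occupied_peg n u j" using assms(2) by (simp add: occupied_peg_def)
    then have "occupied_peg n u k \<Longrightarrow> k = i \<or> occupied_peg n v k \<and> k \<noteq> j" for k
      using other[of k] by auto
    \<comment> \<open>Removing the newly occupied \<open>j\<close> compensates for inserting the
      possibly vacated \<open>i\<close>.\<close>
    then have "?O u \<subseteq> insert i (?O v - {j})" by auto
    then have "card (?O u) \<le> card (insert i (?O v - {j}))" by (intro card_mono) auto
    also have "\<dots> \<le> Suc (card (?O v - {j}))" by (rule card_insert_le_m1) auto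
    also have "\<dots> = card (?O v)" using j ij using card_Suc_Diff1[of "?O v" j] by simp
    finally show ?thesis by (simp add: occupancy_def)
  qed
qed

section \<open>Oriented moves and the three edge classes\<close>

definition hanoi_arcs ::
  "(nat \<Rightarrow> (nat \<Rightarrow> nat) \<Rightarrow> nat \<Rightarrow> bool) \<Rightarrow> (nat \<Rightarrow> (nat \<Rightarrow> nat) \<Rightarrow> nat \<Rightarrow> bool) \<Rightarrow>
   nat \<Rightarrow> nat \<Rightarrow> ((nat \<Rightarrow> nat) \<times> (nat \<Rightarrow> nat)) set" where
  "hanoi_arcs P Q p n =
     {(u, v). \<exists>d i j. hanoi_move p n d i j u v \<and> P n u i \<and> Q n u j}"

lemma finite_hanoi_states [simp]: "finite (hanoi_states p n)"
  by (auto simp: hanoi_states_def intro: finite_PiE)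

lemma finite_hanoi_arcs [simp]: "finite (hanoi_arcs P Q p n)"
  by (rule finite_subset[of _ "hanoi_states p n \<times> hanoi_states p n"])
     (auto simp: hanoi_arcs_def hanoi_move_def)

lemma irrefl_hanoi_arcs: "irrefl (hanoi_arcs P Q p n)"
  by (auto simp: irrefl_def hanoi_arcs_def hanoi_move_def)

lemma hanoi_edges_of_type_arcs:
  assumes "\<And>d i j u v. hanoi_move p n d i j u v \<Longrightarrow> P n u i \<Longrightarrow> Q n u j \<Longrightarrow>
    occupancy p n u \<le> occupancy p n v"
  shows "hanoi_edges_of_type P Q p n = {{u, v} | u v. (u, v) \<in> hanoi_arcs P Q p n}"
  unfolding hanoi_edges_of_type_def hanoi_edges_def hanoi_arcs_def using assms by blast

text \<open>After the move the disc is alone on \<open>j\<close>, and \<open>i\<close> has become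
  empty.\<close>

lemma sym_arcs_singleton_empty: "sym (hanoi_arcs singleton_peg empty_peg p n)"
proof (rule symI)
  fix u v assume "(u, v) \<in> hanoi_arcs singleton_peg empty_peg p n"
  then obtain d i j where m: "hanoi_move p n d i j u v" "singleton_peg n u i" "empty_peg n u j"
    by (auto simp: hanoi_arcs_def)
  then have "singleton_peg n v j" "empty_peg n v i"
    using card_discs_on_move[OF m(1)] by (auto simp: peg_type_card)
  then show "(v, u) \<in> hanoi_arcs singleton_peg empty_peg p n"
    using hanoi_move_rev[OF m(1)] by (auto simp: hanoi_arcs_def)
qed

text \<open>The moved disc joins another one on \<open>j\<close>, and \<open>i\<close> keeps at
  least one disc.\<close>

lemma sym_arcs_multiton_occupied: "sym (hanoi_arcs multiton_peg occupied_peg p n)"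
proof (rule symI)
  fix u v assume "(u, v) \<in> hanoi_arcs multiton_peg occupied_peg p n"
  then obtain d i j where
    m: "hanoi_move p n d i j u v" "multiton_peg n u i" "occupied_peg n u j"
    by (auto simp: hanoi_arcs_def)
  then have "multiton_peg n v j" "occupied_peg n v i"
    using card_discs_on_move[OF m(1)] by (auto simp: peg_type_card)
  then show "(v, u) \<in> hanoi_arcs multiton_peg occupied_peg p n"
    using hanoi_move_rev[OF m(1)] by (auto simp: hanoi_arcs_def)
qed

text \<open>Used twice: for antisymmetry, and to replace the count of singleton-to-occupied arcs,
  which is not a plain product, by that of multiton-to-empty arcs.\<close>

lemma arcs_multiton_empty_converse:
  "hanoi_arcs singleton_peg occupied_peg p n = (hanoi_arcs multiton_peg empty_peg p n)\<inverse>"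
proof -
  have "multiton_peg n v j \<and> empty_peg n v i \<longleftrightarrow> singleton_peg n u i \<and> occupied_peg n u j"
    if "hanoi_move p n d i j u v" for d i j u v
    using card_discs_on_move[OF that] by (auto simp: peg_type_card)
  then show ?thesis
    unfolding hanoi_arcs_def by (auto dest: hanoi_move_rev) (meson hanoi_move_rev)+
qed

text \<open>If both orders occurred, the unique move from \<open>u\<close> to \<open>v\<close> would
  start from a peg that is both a multiton and a singleton.\<close>

lemma asym_arcs_multiton_empty: "asym (hanoi_arcs multiton_peg empty_peg p n)"
proof (rule asymI)
  fix u v assume uv: "(u, v) \<in> hanoi_arcs multiton_peg empty_peg p n"
  show "(v, u) \<notin> hanoi_arcs multiton_peg empty_peg p n"
  proof
    assume "(v, u) \<in> hanoi_arcs multiton_peg empty_peg p n"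
    then have "(u, v) \<in> hanoi_arcs singleton_peg occupied_peg p n"
      by (simp add: arcs_multiton_empty_converse)
    with uv obtain d i j d' i' j' where
      "hanoi_move p n d i j u v" "multiton_peg n u i" and
      "hanoi_move p n d' i' j' u v" "singleton_peg n u i'"
      by (auto simp: hanoi_arcs_def)
    then show False using hanoi_move_unique by (fastforce simp: peg_type_card)
  qed
qed

lemma card_E1: "2 * card (hanoi_E1 p n) = card (hanoi_arcs singleton_peg empty_peg p n)"
proof -
  have "hanoi_E1 p n = {{u, v} | u v. (u, v) \<in> hanoi_arcs singleton_peg empty_peg p n}"
    unfolding hanoi_E1_def by (rule hanoi_edges_of_type_arcs) (auto intro: occupancy_move_mono)
  then show ?thesis
    by (simp only: card_unordered_pairs_sym[OF finite_hanoi_arcs sym_arcs_singleton_empty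
      irrefl_hanoi_arcs])
qed

lemma card_E2: "2 * card (hanoi_E2 p n) = card (hanoi_arcs multiton_peg occupied_peg p n)"
proof -
  have "hanoi_E2 p n = {{u, v} | u v. (u, v) \<in> hanoi_arcs multiton_peg occupied_peg p n}"
    unfolding hanoi_E2_def by (rule hanoi_edges_of_type_arcs) (auto intro: occupancy_move_mono)
  then show ?thesis
    by (simp only: card_unordered_pairs_sym[OF finite_hanoi_arcs sym_arcs_multiton_occupied
      irrefl_hanoi_arcs])
qed

lemma card_E3: "card (hanoi_E3 p n) = card (hanoi_arcs multiton_peg empty_peg p n)"
proof -
  have "hanoi_E3 p n = {{u, v} | u v. (u, v) \<in> hanoi_arcs multiton_peg empty_peg p n}"
    unfolding hanoi_E3_def by (rule hanoi_edges_of_type_arcs) (auto intro: occupancy_move_mono)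
  then show ?thesis by (simp only: card_unordered_pairs_antisym[OF asym_arcs_multiton_empty])
qed

section \<open>Counting moves\<close>

definition legal_pairs ::
  "(nat \<Rightarrow> (nat \<Rightarrow> nat) \<Rightarrow> nat \<Rightarrow> bool) \<Rightarrow> (nat \<Rightarrow> (nat \<Rightarrow> nat) \<Rightarrow> nat \<Rightarrow> bool) \<Rightarrow>
   nat \<Rightarrow> nat \<Rightarrow> (nat \<Rightarrow> nat) \<Rightarrow> (nat \<times> nat) set" where
  "legal_pairs P Q p n u =
     {(i, j) \<in> {0..<p} \<times> {0..<p}. top_disc n u i < top_disc n u j \<and> P n u i \<and> Q n u j}"

lemma finite_legal_pairs [simp]: "finite (legal_pairs P Q p n u)"
  by (rule finite_subset[of _ "{0..<p} \<times> {0..<p}"]) (auto simp: legal_pairs_def)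

text \<open>By \<open>hanoi_move_iff\<close> a state with a legal pair of pegs yields an arc, and
  every arc arises so; by \<open>hanoi_move_unique\<close> it arises only once.\<close>

lemma card_hanoi_arcs:
  "card (hanoi_arcs P Q p n) = (\<Sum>u\<in>hanoi_states p n. card (legal_pairs P Q p n u))"
proof -
  let ?f = "\<lambda>(u, i, j). (u, u(top_disc n u i := j))"
  let ?D = "SIGMA u:hanoi_states p n. legal_pairs P Q p n u"
  have move: "hanoi_move p n (top_disc n u i) i j u (u(top_disc n u i := j))"
    if "(u, i, j) \<in> ?D" for u i j
    using that by (auto simp: hanoi_move_iff legal_pairs_def)
  have inj: "inj_on ?f ?D"
  proof (rule inj_onI)
    fix x y assume x: "x \<in> ?D" and y: "y \<in> ?D" and eq: "?f x = ?f y"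
    obtain u i j where x_eq: "x = (u, i, j)" by (cases x)
    obtain u' i' j' where y_eq: "y = (u', i', j')" by (cases y)
    have "u' = u" using eq by (simp add: x_eq y_eq)
    have v: "u'(top_disc n u' i' := j') = u(top_disc n u i := j)"
      using eq unfolding x_eq y_eq prod.case prod.inject by (elim conjE) (rule sym)
    have "hanoi_move p n (top_disc n u i) i j u (u(top_disc n u i := j))"
      using x by (intro move) (simp add: x_eq)
    moreover have "hanoi_move p n (top_disc n u' i') i' j' u' (u'(top_disc n u' i' := j'))"
      using y by (intro move) (simp add: y_eq)
    then have "hanoi_move p n (top_disc n u' i') i' j' u (u(top_disc n u i := j))"
      unfolding v by (simp only: \<open>u' = u\<close>)
    ultimately show "x = y" using hanoi_move_unique \<open>u' = u\<close> by (simp add: x_eq y_eq)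
  qed
  have image: "?f ` ?D = hanoi_arcs P Q p n"
  proof (intro equalityI subsetI)
    fix x assume "x \<in> ?f ` ?D"
    then obtain u i j where "(u, i, j) \<in> ?D" "x = ?f (u, i, j)" by auto
    then show "x \<in> hanoi_arcs P Q p n"
      using move[of u i j] by (auto simp: hanoi_arcs_def legal_pairs_def)
  next
    fix x assume "x \<in> hanoi_arcs P Q p n"
    then obtain u v d i j where x: "x = (u, v)" "hanoi_move p n d i j u v" "P n u i" "Q n u j"
      by (auto simp: hanoi_arcs_def)
    then have "(u, i, j) \<in> ?D" "x = ?f (u, i, j)"
      by (auto simp: hanoi_move_iff legal_pairs_def)
    then show "x \<in> ?f ` ?D" by blast
  qed
  have "card (hanoi_arcs P Q p n) = card ?D"
    unfolding image[symmetric] by (rule card_image[OF inj])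
  then show ?thesis by simp
qed

section \<open>Numbers of pegs of each type and of moves out of one state\<close>

definition num_singletons :: "nat \<Rightarrow> nat \<Rightarrow> (nat \<Rightarrow> nat) \<Rightarrow> nat" where
  "num_singletons p n s = card {k \<in> {0..<p}. singleton_peg n s k}"

lemma num_singletons_le: "num_singletons p n s \<le> occupancy p n s"
  unfolding num_singletons_def occupancy_def by (rule card_mono) (auto simp: peg_type_card)

lemma occupied_pegs_image:
  "s \<in> hanoi_states p n \<Longrightarrow> {k \<in> {0..<p}. occupied_peg n s k} = s ` {1..n}"
  by (auto simp: occupied_peg_def empty_peg_def discs_on_def hanoi_states_def PiE_iff)

lemma occupancy_le: "s \<in> hanoi_states p n \<Longrightarrow> occupancy p n s \<le> min n p"
proof -
  assume s: "s \<in> hanoi_states p n"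
  have "occupancy p n s \<le> n"
    using card_image_le[of "{1..n}" s] unfolding occupancy_def occupied_pegs_image[OF s] by simp
  moreover have "occupancy p n s \<le> card {0..<p}"
    unfolding occupancy_def by (rule card_mono) auto
  ultimately show ?thesis by simp
qed

lemma occupancy_pos: "s \<in> hanoi_states p n \<Longrightarrow> n \<ge> 1 \<Longrightarrow> occupancy p n s \<ge> 1"
  unfolding occupancy_def by (subst occupied_pegs_image) (simp_all add: Suc_le_eq card_gt_0_iff)

lemma card_empty_pegs: "card {k \<in> {0..<p}. empty_peg n s k} = p - occupancy p n s"
proof -
  have "{k \<in> {0..<p}. empty_peg n s k} = {0..<p} - {k \<in> {0..<p}. occupied_peg n s k}"
    by (auto simp: occupied_peg_def)
  moreover have "{k \<in> {0..<p}. occupied_peg n s k} \<subseteq> {0..<p}" by blast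
  ultimately show ?thesis by (simp only: occupancy_def card_Diff_subset finite_subset
      finite_atLeastLessThan card_atLeastLessThan diff_zero)
qed

lemma card_multiton_pegs:
  "card {k \<in> {0..<p}. multiton_peg n s k} = occupancy p n s - num_singletons p n s"
proof -
  have "{k \<in> {0..<p}. multiton_peg n s k} =
      {k \<in> {0..<p}. occupied_peg n s k} - {k \<in> {0..<p}. singleton_peg n s k}"
    by (auto simp: peg_type_card)
  moreover have "{k \<in> {0..<p}. singleton_peg n s k} \<subseteq> {k \<in> {0..<p}. occupied_peg n s k}"
    by (auto simp: peg_type_card)
  ultimately show ?thesis by (simp add: occupancy_def num_singletons_def card_Diff_subset)
qed

text \<open>An occupied peg has an actual top disc, below the virtual top \<open>n + 1\<close> of
  every empty peg. So legality is automatic and the pairs form a product.\<close>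

lemma card_legal_pairs_to_empty:
  assumes "\<And>k. P n s k \<Longrightarrow> occupied_peg n s k"
  shows "card (legal_pairs P empty_peg p n s) =
    card {k \<in> {0..<p}. P n s k} * (p - occupancy p n s)"
proof -
  have "top_disc n s i < top_disc n s j" if "P n s i" "empty_peg n s j" for i j
    using assms[OF that(1)] that(2) top_disc_le_Suc[of n s i]
    by (auto simp: occupied_peg_def less_le simp flip: top_disc_empty_iff)
  then have "legal_pairs P empty_peg p n s =
      {k \<in> {0..<p}. P n s k} \<times> {k \<in> {0..<p}. empty_peg n s k}"
    by (auto simp: legal_pairs_def)
  then show ?thesis by (simp only: card_empty_pegs card_cartesian_product)
qed

lemma card_off_diagonal:
  fixes A :: "'a set"
  assumes "finite A"
  shows "card {(i, j) \<in> A \<times> A. i \<noteq> j} = card A * (card A - 1)"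
proof -
  have "{(i, j) \<in> A \<times> A. i \<noteq> j} = (SIGMA i:A. A - {i})" by auto
  then show ?thesis using assms by (simp add: card_Diff_singleton)
qed

text \<open>Of the two orders of a pair of distinct pegs exactly one is legal, unless both pegs are
  empty; then neither is.\<close>

lemma card_legal_pairs_all:
  fixes s p n
  defines "m \<equiv> occupancy p n s"
  shows "2 * card (legal_pairs (\<lambda>_ _ _. True) (\<lambda>_ _ _. True) p n s) + (p - m) * (p - m - 1)
    = p * (p - 1)"
proof -
  let ?L = "legal_pairs (\<lambda>_ _ _. True) (\<lambda>_ _ _. True) p n s"
  let ?E = "{k \<in> {0..<p}. empty_peg n s k}"
  let ?B = "{(i, j) \<in> ?E \<times> ?E. i \<noteq> j}"
  have finB: "finite ?B" by (rule finite_subset[of _ "?E \<times> ?E"]) auto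
  have finC: "finite (?L\<inverse>)" by simp
  \<comment> \<open>Ordered pairs of distinct pegs are sorted by whether the first top is smaller,
    larger or equal; by \<open>top_disc_eq_iff\<close> equality means that both pegs are
    empty.\<close>
  have split: "{(i, j) \<in> {0..<p} \<times> {0..<p}. i \<noteq> j} = (?L \<union> ?L\<inverse>) \<union> ?B"
  proof (intro set_eqI)
    fix x :: "nat \<times> nat"
    obtain i j where "x = (i, j)" by (cases x)
    then show "x \<in> {(i, j) \<in> {0..<p} \<times> {0..<p}. i \<noteq> j} \<longleftrightarrow> x \<in> (?L \<union> ?L\<inverse>) \<union> ?B"
      using top_disc_eq_iff[of i j n s] by (auto simp: legal_pairs_def)
  qed
  have disj: "?L \<inter> ?L\<inverse> = {}" "(?L \<union> ?L\<inverse>) \<inter> ?B = {}"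
    by (auto simp: legal_pairs_def simp flip: top_disc_empty_iff)
  have "p * (p - 1) = card ((?L \<union> ?L\<inverse>) \<union> ?B)"
    using card_off_diagonal[of "{0..<p}"] unfolding split by simp
  also have "\<dots> = card (?L \<union> ?L\<inverse>) + card ?B"
    using disj finB finC by (intro card_Un_disjoint) auto
  also have "card (?L \<union> ?L\<inverse>) = card ?L + card (?L\<inverse>)"
    using disj finC by (intro card_Un_disjoint) auto
  also have "card (?L\<inverse>) = card ?L" by (rule card_inverse)
  also have "card ?B = (p - m) * (p - m - 1)"
    using card_off_diagonal[of ?E] unfolding card_empty_pegs m_def by simp
  finally show ?thesis by simp
qed

lemma card_legal_pairs_split:
  "card (legal_pairs (\<lambda>_ _ _. True) (\<lambda>_ _ _. True) p n s) =
     card (legal_pairs singleton_peg empty_peg p n s) +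
     card (legal_pairs singleton_peg occupied_peg p n s) +
     card (legal_pairs multiton_peg empty_peg p n s) +
     card (legal_pairs multiton_peg occupied_peg p n s)"
  (is "card ?L = card ?SE + card ?SO + card ?ME + card ?MO")
proof -
  \<comment> \<open>The source of a legal pair has top at most \<open>n\<close>, so it is occupied
    and the four type combinations exhaust all cases.\<close>
  have source: "singleton_peg n s i \<or> multiton_peg n s i"
    if "top_disc n s i < top_disc n s j" for i j
  proof -
    have "\<not> empty_peg n s i"
      using that top_disc_le_Suc[of n s j] by (simp flip: top_disc_empty_iff)
    then show ?thesis by (auto simp: peg_type_card)
  qed
  have L: "?L = (?SE \<union> ?SO) \<union> (?ME \<union> ?MO)"
    using source by (auto simp: legal_pairs_def occupied_peg_def)
  have "card ?L = card (?SE \<union> ?SO) + card (?ME \<union> ?MO)"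
    unfolding L by (intro card_Un_disjoint finite_UnI finite_legal_pairs)
      (auto simp: legal_pairs_def peg_type_card)
  also have "card (?SE \<union> ?SO) = card ?SE + card ?SO"
    by (intro card_Un_disjoint finite_UnI finite_legal_pairs)
      (auto simp: legal_pairs_def peg_type_card)
  also have "card (?ME \<union> ?MO) = card ?ME + card ?MO"
    by (intro card_Un_disjoint finite_UnI finite_legal_pairs)
      (auto simp: legal_pairs_def peg_type_card)
  finally show ?thesis by simp
qed

section \<open>Summation over all states, grouped by \<open>\<mu>\<close> and
  \<open>\<nu>\<close>\<close>

lemma sum_hanoi_states:
  fixes f :: "nat \<Rightarrow> nat \<Rightarrow> real"
  assumes "\<And>s. s \<in> hanoi_states p n \<Longrightarrow> occupancy p n s = 0 \<Longrightarrow> f 0 0 = 0"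
  shows "(\<Sum>s\<in>hanoi_states p n. f (occupancy p n s) (num_singletons p n s)) =
    (\<Sum>\<mu> = 1..min n p. \<Sum>\<nu> = 0..\<mu>. f \<mu> \<nu> * real (hanoi_O p n \<nu> \<mu>))"
proof -
  let ?S = "hanoi_states p n"
  let ?T = "SIGMA \<mu>:{0..min n p}. {0..\<mu>}"
  let ?g = "\<lambda>s. (occupancy p n s, num_singletons p n s)"
  have O: "hanoi_O p n \<nu> \<mu> = card {s \<in> ?S. ?g s = (\<mu>, \<nu>)}" for \<mu> \<nu>
    by (simp add: hanoi_O_def num_singletons_def)
  have "?g ` ?S \<subseteq> ?T"
    using occupancy_le num_singletons_le by fastforce
  then have "(\<Sum>s\<in>?S. f (occupancy p n s) (num_singletons p n s)) =
      (\<Sum>y\<in>?T. \<Sum>s\<in>{s \<in> ?S. ?g s = y}. f (occupancy p n s) (num_singletons p n s))"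
    by (intro sum.group[symmetric]) auto
  also have "\<dots> = (\<Sum>(\<mu>, \<nu>)\<in>?T. f \<mu> \<nu> * real (hanoi_O p n \<nu> \<mu>))"
    by (intro sum.cong) (auto simp: O)
  also have "\<dots> = (\<Sum>\<mu> = 0..min n p. \<Sum>\<nu> = 0..\<mu>. f \<mu> \<nu> * real (hanoi_O p n \<nu> \<mu>))"
    by (simp add: sum.Sigma)
  also have "\<dots> = (\<Sum>\<mu> = 1..min n p. \<Sum>\<nu> = 0..\<mu>. f \<mu> \<nu> * real (hanoi_O p n \<nu> \<mu>))"
  proof -
    \<comment> \<open>The target sum starts at 1, so the term for \<open>\<mu> = 0\<close> must
      vanish: either no state has occupancy 0, or the assumption applies to such a state.\<close>
    have "f 0 0 = 0 \<or> hanoi_O p n 0 0 = 0"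
      using assms by (auto simp: O card_eq_0_iff)
    then show ?thesis by (auto simp: sum.atLeast_Suc_atMost)
  qed
  finally show ?thesis .
qed

lemma real_card_arcs_singleton_empty:
  "real (card (hanoi_arcs singleton_peg empty_peg p n)) =
     (\<Sum>s\<in>hanoi_states p n. (real p - real (occupancy p n s)) * real (num_singletons p n s))"
  unfolding card_hanoi_arcs of_nat_sum
proof (intro sum.cong refl)
  fix s assume "s \<in> hanoi_states p n"
  then have "occupancy p n s \<le> p" using occupancy_le by fastforce
  moreover have "card (legal_pairs singleton_peg empty_peg p n s) =
      num_singletons p n s * (p - occupancy p n s)"
    unfolding num_singletons_def by (rule card_legal_pairs_to_empty) (auto simp: peg_type_card)
  ultimately show "real (card (legal_pairs singleton_peg empty_peg p n s)) =
      (real p - real (occupancy p n s)) * real (num_singletons p n s)"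
    by (simp add: of_nat_diff)
qed

lemma real_card_arcs_multiton_empty:
  "real (card (hanoi_arcs multiton_peg empty_peg p n)) =
     (\<Sum>s\<in>hanoi_states p n. (real p - real (occupancy p n s)) *
       (real (occupancy p n s) - real (num_singletons p n s)))"
  unfolding card_hanoi_arcs of_nat_sum
proof (intro sum.cong refl)
  fix s assume "s \<in> hanoi_states p n"
  then have "occupancy p n s \<le> p" using occupancy_le by fastforce
  moreover have "card (legal_pairs multiton_peg empty_peg p n s) =
      (occupancy p n s - num_singletons p n s) * (p - occupancy p n s)"
    unfolding card_multiton_pegs[symmetric]
    by (rule card_legal_pairs_to_empty) (auto simp: peg_type_card)
  ultimately show "real (card (legal_pairs multiton_peg empty_peg p n s)) =
      (real p - real (occupancy p n s)) * (real (occupancy p n s) - real (num_singletons p n s))"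
    using num_singletons_le[of p n s] by (simp add: of_nat_diff)
qed

lemma real_card_legal_pairs_all:
  assumes "s \<in> hanoi_states p n"
  shows "real (card (legal_pairs (\<lambda>_ _ _. True) (\<lambda>_ _ _. True) p n s)) =
    real (p choose 2) -
    1 / 2 * ((real p - real (occupancy p n s)) * (real p - real (occupancy p n s) - 1))"
proof -
  let ?m = "occupancy p n s"
  have m: "?m \<le> p" using occupancy_le[OF assms] by simp
  \<comment> \<open>At \<open>q = 0\<close> the truncated \<open>q - 1\<close> differs from the real
    one, but the factor \<open>q\<close> cancels the error.\<close>
  have pred: "real (q * (q - 1)) = real q * (real q - 1)" for q :: nat by (cases q) (simp_all add: algebra_simps)
  \<comment> \<open>Evenness makes the integer division in \<open>choose_two\<close> exact.\<close>
  have "even (p * (p - 1))" by auto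
  then have "real (p choose 2) = real (p * (p - 1)) / 2"
    by (simp only: choose_two real_of_nat_div of_nat_numeral)
  moreover have "2 * real (card (legal_pairs (\<lambda>_ _ _. True) (\<lambda>_ _ _. True) p n s)) +
      real ((p - ?m) * (p - ?m - 1)) = real (p * (p - 1))"
    using arg_cong[OF card_legal_pairs_all[of p n s], of real] by simp
  ultimately show ?thesis
    unfolding pred of_nat_diff[OF m] by linarith
qed

text \<open>All arcs, minus the singleton-to-empty ones, minus twice the multiton-to-empty ones; the
  second copy stands for the singleton-to-occupied arcs.\<close>

lemma real_card_arcs_multiton_occupied:
  "real (card (hanoi_arcs multiton_peg occupied_peg p n)) =
     real (p choose 2) * real p ^ n -
     1 / 2 * (\<Sum>s\<in>hanoi_states p n. (real p - real (occupancy p n s)) *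
       (real p + 3 * real (occupancy p n s) - 2 * real (num_singletons p n s) - 1))"
proof -
  let ?S = "hanoi_states p n"
  let ?a = "\<lambda>s. real p - real (occupancy p n s)"
  let ?L = "legal_pairs (\<lambda>_ _ _. True) (\<lambda>_ _ _. True) p n"
  have cardS: "card ?S = p ^ n" by (simp add: hanoi_states_def card_PiE)
  have "(\<Sum>s\<in>?S. card (?L s)) =
      card (hanoi_arcs singleton_peg empty_peg p n) +
      card (hanoi_arcs singleton_peg occupied_peg p n) +
      card (hanoi_arcs multiton_peg empty_peg p n) +
      card (hanoi_arcs multiton_peg occupied_peg p n)"
    by (simp add: card_hanoi_arcs card_legal_pairs_split sum.distrib)
  also have "card (hanoi_arcs singleton_peg occupied_peg p n) =
      card (hanoi_arcs multiton_peg empty_peg p n)"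
    by (simp add: arcs_multiton_empty_converse card_inverse)
  finally have "real (card (hanoi_arcs multiton_peg occupied_peg p n)) =
      (\<Sum>s\<in>?S. real (card (?L s))) -
      real (card (hanoi_arcs singleton_peg empty_peg p n)) -
      2 * real (card (hanoi_arcs multiton_peg empty_peg p n))"
    by (simp flip: of_nat_sum)
  \<comment> \<open>With \<open>a = p - \<mu>\<close>, the amount subtracted from
    \<open>p choose 2\<close> is \<open>a(a - 1)/2 + a\<nu> + 2a(\<mu> - \<nu>) = a(p + 3\<mu> -
    2\<nu> - 1)/2\<close>.\<close>
  also have "\<dots> = (\<Sum>s\<in>?S. real (p choose 2) - 1 / 2 * (?a s *
      (real p + 3 * real (occupancy p n s) - 2 * real (num_singletons p n s) - 1)))"
    unfolding real_card_arcs_singleton_empty real_card_arcs_multiton_empty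
      sum_distrib_left sum_subtractf[symmetric]
    by (intro sum.cong) (simp_all add: real_card_legal_pairs_all field_simps)
  also have "\<dots> = real (p choose 2) * real p ^ n - 1 / 2 * (\<Sum>s\<in>?S. ?a s *
      (real p + 3 * real (occupancy p n s) - 2 * real (num_singletons p n s) - 1))"
    by (simp only: sum_subtractf sum_distrib_left sum_constant cardS of_nat_power mult.commute)
  finally show ?thesis .
qed

theorem mainTheorem3:
  fixes p n :: nat
  assumes "p \<ge> 3"
  shows
    "real (card (hanoi_E1 p n)) =
       1 / 2 * (\<Sum>\<mu> = 1..min n p. (real p - real \<mu>) *
         (\<Sum>\<nu> = 0..\<mu>. real \<nu> * real (hanoi_O p n \<nu> \<mu>)))
     \<and>
     (n \<ge> 1 \<longrightarrow>
       real (card (hanoi_E2 p n)) =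
         1 / 2 * real (p choose 2) * real p ^ n
         - 1 / 4 * (\<Sum>\<mu> = 1..min n p. (real p - real \<mu>) *
             (\<Sum>\<nu> = 0..\<mu>. (real p + 3 * real \<mu> - 2 * real \<nu> - 1) * real (hanoi_O p n \<nu> \<mu>))))
     \<and>
     real (card (hanoi_E3 p n)) =
       (\<Sum>\<mu> = 1..min n p. (real p - real \<mu>) *
         (\<Sum>\<nu> = 0..\<mu>. (real \<mu> - real \<nu>) * real (hanoi_O p n \<nu> \<mu>)))"
proof (intro conjI impI)
  have "2 * real (card (hanoi_E1 p n)) =
      (\<Sum>s\<in>hanoi_states p n. (real p - real (occupancy p n s)) * real (num_singletons p n s))"
    using card_E1[of p n] real_card_arcs_singleton_empty[of p n] by linarith
  also have "\<dots> = (\<Sum>\<mu> = 1..min n p. (real p - real \<mu>) *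
      (\<Sum>\<nu> = 0..\<mu>. real \<nu> * real (hanoi_O p n \<nu> \<mu>)))"
    \<comment> \<open>This \<open>f\<close> vanishes at \<open>(0, 0)\<close>, so the case
      \<open>n = 0\<close> is included; the same holds for \<open>hanoi_E3\<close>.\<close>
    by (subst sum_hanoi_states[where f = "\<lambda>\<mu> \<nu>. (real p - real \<mu>) * real \<nu>"])
       (simp_all add: sum_distrib_left mult.assoc)
  finally show "real (card (hanoi_E1 p n)) =
      1 / 2 * (\<Sum>\<mu> = 1..min n p. (real p - real \<mu>) *
        (\<Sum>\<nu> = 0..\<mu>. real \<nu> * real (hanoi_O p n \<nu> \<mu>)))"
    by simp
next
  have "real (card (hanoi_E3 p n)) =
      (\<Sum>s\<in>hanoi_states p n. (real p - real (occupancy p n s)) *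
        (real (occupancy p n s) - real (num_singletons p n s)))"
    by (simp only: card_E3 real_card_arcs_multiton_empty)
  also have "\<dots> = (\<Sum>\<mu> = 1..min n p. (real p - real \<mu>) *
      (\<Sum>\<nu> = 0..\<mu>. (real \<mu> - real \<nu>) * real (hanoi_O p n \<nu> \<mu>)))"
    by (subst sum_hanoi_states[where f = "\<lambda>\<mu> \<nu>. (real p - real \<mu>) * (real \<mu> - real \<nu>)"])
       (simp_all add: sum_distrib_left mult.assoc)
  finally show "real (card (hanoi_E3 p n)) = (\<Sum>\<mu> = 1..min n p. (real p - real \<mu>) *
      (\<Sum>\<nu> = 0..\<mu>. (real \<mu> - real \<nu>) * real (hanoi_O p n \<nu> \<mu>)))" .
next
  assume n: "n \<ge> 1"
  \<comment> \<open>Now \<open>f 0 0 = p(p - 1)\<close> is nonzero, so occupancy 0 has to be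
    excluded by \<open>n \<ge> 1\<close>. For \<open>n = 0\<close> there are no edges and the sum is
    empty, but the binomial term stays positive.\<close>
  have pos: "occupancy p n s \<noteq> 0" if "s \<in> hanoi_states p n" for s
    using occupancy_pos[OF that n] by simp
  have "(\<Sum>s\<in>hanoi_states p n. (real p - real (occupancy p n s)) *
       (real p + 3 * real (occupancy p n s) - 2 * real (num_singletons p n s) - 1)) =
      (\<Sum>\<mu> = 1..min n p. (real p - real \<mu>) *
        (\<Sum>\<nu> = 0..\<mu>. (real p + 3 * real \<mu> - 2 * real \<nu> - 1) * real (hanoi_O p n \<nu> \<mu>)))"
    by (subst sum_hanoi_states
        [where f = "\<lambda>\<mu> \<nu>. (real p - real \<mu>) * (real p + 3 * real \<mu> - 2 * real \<nu> - 1)"])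
       (simp_all add: sum_distrib_left mult.assoc pos)
  moreover have "2 * real (card (hanoi_E2 p n)) =
      real (card (hanoi_arcs multiton_peg occupied_peg p n))"
    using card_E2[of p n] by linarith
  ultimately show "real (card (hanoi_E2 p n)) =
      1 / 2 * real (p choose 2) * real p ^ n
      - 1 / 4 * (\<Sum>\<mu> = 1..min n p. (real p - real \<mu>) *
          (\<Sum>\<nu> = 0..\<mu>. (real p + 3 * real \<mu> - 2 * real \<nu> - 1) * real (hanoi_O p n \<nu> \<mu>)))"
    by (simp add: real_card_arcs_multiton_occupied)
qed

end
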